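(* Let $\alpha,\beta\in[0,2\pi)$, $s=\sin(\alpha+\beta)\neq0$, $r=\sin(\alpha-\beta)$ with $0<|r|<1$. Let $v(k)=d\theta_0(k)/dk$ be the group velocity of the edge state, $M(k)=\left|1/(d^2\theta_0(k)/dk^2)\right|$ its effective mass, $m_0(k)$ the density of the edge state at $k\in[0,2\pi)$, and $g$ the density function of the limit distribution. Then we have the following parametric plot of the density function: $$\{(y,g(y)):\ y\in\mathbb{R}\}=\left\{\left(v(k),\ \frac{2m_0^2(k)M(k)}{\pi}\right):\ k\in[0,2\pi)\right\}.$$
   Context: For $k\in[0,2\pi)$, $$\theta_0(k)=\begin{cases}\arcsin(-r\sin k)&\text{if } s\cos k\le0,\\ \pi-\arcsin(-r\sin k)&\text{if } s\cos k>0,\end{cases}\qquad m_0(k)=\frac{|s\cos k|}{\sqrt{1-r^2\sin^2k}}.$$ The density of the limit distribution is $$g(y)=\frac{2s^2}{r^2}y^2f_K(y;|r|)\times\begin{cases}\mathbf{1}_{[0,\infty)}(y)&\text{if } sr>0,\\ \mathbf{1}_{(-\infty,0]}(y)&\text{if } sr<0,\end{cases}\qquad f_K(x;p)=\frac{\sqrt{1-p^2}}{\pi(1-x^2)\sqrt{p^2-x^2}}\,\mathbf{1}_{(-p,p)}(x)\quad(0<p<1).$$ (It is the density of the limit, after rescaling by time, of the finding probability on the boundary self-loops of the associated two-dimensional quantum walk with parameters $(\alpha,\beta)$.)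
   Formalization: The set equality is stated only for y with g(y) ≠ 0, and for k in [0,2π) where v(k) and M(k) exist (excluding k = 0, π/2, π, 3π/2); as written it fails, since (y,0) with |y| > |r| is on the left but |v(k)| ≤ |r|. *)

theory Defs
  imports "HOL-Analysis.Analysis"
begin

text \<open>
  Throughout, \<open>s\<close> and \<open>r\<close> stand for \<open>sin (\<alpha> + \<beta>)\<close> and \<open>sin (\<alpha> - \<beta>)\<close>, where \<open>(\<alpha>, \<beta>)\<close> are the
  parameters of the quantum walk.  The formulas are used for all real \<open>k\<close>, which is the
  \<open>2 * pi\<close>-periodic extension from \<open>{0..<2 * pi}\<close>.
\<close>

definition theta0 :: "real \<Rightarrow> real \<Rightarrow> real \<Rightarrow> real" where
  "theta0 s r k =
     (if s * cos k \<le> 0 then arcsin (- r * sin k) else pi - arcsin (- r * sin k))"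

definition edge_density :: "real \<Rightarrow> real \<Rightarrow> real \<Rightarrow> real" where
  "edge_density s r k = \<bar>s * cos k\<bar> / sqrt (1 - r\<^sup>2 * (sin k)\<^sup>2)"

definition group_velocity :: "real \<Rightarrow> real \<Rightarrow> real \<Rightarrow> real" where
  "group_velocity s r k = deriv (theta0 s r) k"

definition effective_mass :: "real \<Rightarrow> real \<Rightarrow> real \<Rightarrow> real" where
  "effective_mass s r k = \<bar>1 / deriv (deriv (theta0 s r)) k\<bar>"

text \<open>
  The momenta at which the group velocity and the effective mass exist.  For \<open>s \<noteq> 0\<close> and
  \<open>0 < \<bar>r\<bar> < 1\<close> exactly four points of \<open>{0..<2 * pi}\<close> are excluded: at \<open>pi / 2\<close> and
  \<open>3 * pi / 2\<close> the function \<open>theta0 s r\<close> jumps, and at \<open>0\<close> and \<open>pi\<close> its second derivative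
  vanishes, so that the mass is infinite.
\<close>
definition regular_momentum :: "real \<Rightarrow> real \<Rightarrow> real \<Rightarrow> bool" where
  "regular_momentum s r k \<longleftrightarrow>
     theta0 s r differentiable (at k) \<and>
     deriv (theta0 s r) differentiable (at k) \<and>
     deriv (deriv (theta0 s r)) k \<noteq> 0"

definition konno_density :: "real \<Rightarrow> real \<Rightarrow> real" where
  "konno_density p x =
     sqrt (1 - p\<^sup>2) / (pi * (1 - x\<^sup>2) * sqrt (p\<^sup>2 - x\<^sup>2)) * indicator {-p<..<p} x"

text \<open>Only the cases \<open>s * r > 0\<close> and \<open>s * r < 0\<close> are of interest.\<close>
definition limit_density :: "real \<Rightarrow> real \<Rightarrow> real \<Rightarrow> real" where
  "limit_density s r y =
     2 * s\<^sup>2 / r\<^sup>2 * y\<^sup>2 * konno_density \<bar>r\<bar> y *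
     (if s * r > 0 then indicator {0..} y else indicator {..0} y)"

end

theory Submission
  imports Defs
begin

text \<open>
  Away from the jumps of \<open>\<theta>\<^sub>0\<close>, with \<open>D = \<surd>(1 - r\<^sup>2 sin\<^sup>2 k)\<close>, one finds
  \<open>v = sgn s \<cdot> r \<bar>cos k\<bar> / D\<close> and \<open>\<bar>\<theta>\<^sub>0''\<bar> = \<bar>r\<bar> (1 - r\<^sup>2) \<bar>sin k\<bar> / D\<^sup>3\<close>.  Since
  \<open>1 - v\<^sup>2 = (1 - r\<^sup>2) / D\<^sup>2\<close> and \<open>r\<^sup>2 - v\<^sup>2 = r\<^sup>2 (1 - r\<^sup>2) sin\<^sup>2 k / D\<^sup>2\<close>, both sides of
  \<open>g(v) = 2 m\<^sub>0\<^sup>2 M / \<pi>\<close> equal \<open>2 s\<^sup>2 cos\<^sup>2 k D / (\<pi> \<bar>r\<bar> (1 - r\<^sup>2) \<bar>sin k\<bar>)\<close>.  Solving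
  \<open>v(k) = y\<close> for \<open>cos\<^sup>2 k\<close> shows that \<open>v\<close> attains every \<open>y\<close> with \<open>g(y) \<noteq> 0\<close>.
\<close>

section \<open>Derivatives of \<open>theta0\<close> away from the zeros of
  \<open>cos\<close>\<close>

lemma one_minus_sq_sin_pos:
  fixes r k :: real
  assumes "\<bar>r\<bar> < 1"
  shows "0 < 1 - r\<^sup>2 * (sin k)\<^sup>2"
proof -
  have "r\<^sup>2 < 1"
    using assms by (simp add: abs_square_less_1)
  moreover have "r\<^sup>2 * (sin k)\<^sup>2 \<le> r\<^sup>2 * 1"
    by (intro mult_left_mono) (simp_all add: abs_square_le_1)
  ultimately show ?thesis by linarith
qed

lemma abs_mult_sin_less_1:
  fixes r k :: real
  assumes "\<bar>r\<bar> < 1"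
  shows "\<bar>r * sin k\<bar> < 1"
  using one_minus_sq_sin_pos[OF assms, of k]
  by (simp add: power_mult_distrib flip: abs_square_less_1)

lemma has_real_derivative_arcsin_sin:
  fixes r k :: real
  assumes "\<bar>r\<bar> < 1"
  shows "((\<lambda>x. arcsin (- r * sin x)) has_real_derivative
           - r * cos k / sqrt (1 - r\<^sup>2 * (sin k)\<^sup>2)) (at k)"
  using abs_mult_sin_less_1[OF assms, of k]
  by (auto intro!: derivative_eq_intros
      simp: power_mult_distrib divide_simps)

text \<open>This gives the second derivative of the branch \<open>arcsin (- r * sin x)\<close>. The
  quotient rule leaves r sin k (D^2 - r^2 cos^2 k) / D^3, and the bracket is the constant 1 -
  r^2.\<close>

lemma has_real_derivative_cos_over_sqrt:
  fixes r k :: real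
  assumes "\<bar>r\<bar> < 1"
  shows "((\<lambda>x. - r * cos x / sqrt (1 - r\<^sup>2 * (sin x)\<^sup>2)) has_real_derivative
           r * (1 - r\<^sup>2) * sin k / sqrt (1 - r\<^sup>2 * (sin k)\<^sup>2) ^ 3) (at k)"
proof -
  define D where "D = sqrt (1 - r\<^sup>2 * (sin k)\<^sup>2)"
  have pos: "0 < 1 - r\<^sup>2 * (sin k)\<^sup>2"
    using one_minus_sq_sin_pos[OF assms] .
  have D: "D > 0" "D\<^sup>2 = 1 - r\<^sup>2 * (sin k)\<^sup>2"
    using pos by (simp_all add: D_def)
  have "((\<lambda>x. - r * cos x / sqrt (1 - r\<^sup>2 * (sin x)\<^sup>2)) has_real_derivative
          (r * sin k * D - (- r * cos k) * (- (r\<^sup>2 * (2 * sin k * cos k)) * (inverse D / 2))) / (D * D)) (at k)"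
    using pos D(1) by (auto intro!: derivative_eq_intros
        simp: D_def mult_ac minus_divide_left simp del: divide_minus_left)
  also have "(r * sin k * D - (- r * cos k) * (- (r\<^sup>2 * (2 * sin k * cos k)) * (inverse D / 2))) / (D * D)
      = r * sin k * (D\<^sup>2 - r\<^sup>2 * (cos k)\<^sup>2) / D ^ 3"
    using D(1) by (simp add: field_simps power2_eq_square power3_eq_cube)
  also have "D\<^sup>2 - r\<^sup>2 * (cos k)\<^sup>2 = 1 - r\<^sup>2"
    unfolding D(2) cos_squared_eq by (simp add: algebra_simps)
  finally show ?thesis by (simp add: D_def mult_ac)
qed

text \<open>Off the zeros of \<open>cos\<close> the case distinction in \<open>theta0\<close> is
  locally constant, so near \<open>k\<close> the function agrees with a single smooth branch and can
  be differentiated there.\<close>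

lemma eventually_sgn_mult_cos:
  fixes s k :: real
  assumes "s * cos k \<noteq> 0"
  shows "\<forall>\<^sub>F x in nhds k. sgn (s * cos x) = sgn (s * cos k)"
proof -
  have lim: "((\<lambda>x. s * cos x) \<longlongrightarrow> s * cos k) (nhds k)"
    by (intro tendsto_intros filterlim_ident)
  show ?thesis
  proof (cases "s * cos k > 0")
    case True
    show ?thesis
      using order_tendstoD(1)[OF lim True] by eventually_elim (use True in simp)
  next
    case False
    then have "s * cos k < 0" using assms by linarith
    show ?thesis
      using order_tendstoD(2)[OF lim \<open>s * cos k < 0\<close>] by eventually_elim (use \<open>s * cos k < 0\<close> in simp)
  qed
qed

text \<open>The two branches add up to \<open>pi\<close>, so their derivatives are opposite; the
  factor \<open>sgn (s * cos k)\<close> records which branch is active.\<close>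

lemma has_real_derivative_theta0:
  assumes "\<bar>r\<bar> < 1" and "s * cos k \<noteq> 0"
  shows "(theta0 s r has_real_derivative
           sgn (s * cos k) * (r * cos k / sqrt (1 - r\<^sup>2 * (sin k)\<^sup>2))) (at k)"
proof (cases "s * cos k > 0")
  case True
  have ev: "\<forall>\<^sub>F x in nhds k. theta0 s r x = pi - arcsin (- r * sin x)"
    using eventually_sgn_mult_cos[OF assms(2)]
    by eventually_elim (use True in \<open>auto simp: theta0_def sgn_if split: if_splits\<close>)
  have "((\<lambda>x. pi - arcsin (- r * sin x)) has_real_derivative
          0 - (- r * cos k / sqrt (1 - r\<^sup>2 * (sin k)\<^sup>2))) (at k)"
    by (intro derivative_intros has_real_derivative_arcsin_sin assms)
  then show ?thesis
    using True by (simp add: DERIV_cong_ev[OF refl ev refl] del: mult_minus_left)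
next
  case False
  have ev: "\<forall>\<^sub>F x in nhds k. theta0 s r x = arcsin (- r * sin x)"
    using eventually_sgn_mult_cos[OF assms(2)]
    by eventually_elim (use False assms(2) in \<open>auto simp: theta0_def sgn_if split: if_splits\<close>)
  have "s * cos k < 0"
    using False assms(2) by linarith
  then have "sgn (s * cos k) = -1"
    by (rule sgn_neg)
  then show ?thesis
    using has_real_derivative_arcsin_sin[OF assms(1), of k]
    by (simp add: DERIV_cong_ev[OF refl ev refl] del: mult_minus_left)
qed

lemma group_velocity_eq:
  assumes "\<bar>r\<bar> < 1" and "s * cos k \<noteq> 0"
  shows "group_velocity s r k = sgn s * r * \<bar>cos k\<bar> / sqrt (1 - r\<^sup>2 * (sin k)\<^sup>2)"
  using DERIV_imp_deriv[OF has_real_derivative_theta0[OF assms]]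
  by (simp add: group_velocity_def sgn_mult abs_sgn mult_ac)

text \<open>The sign is frozen to \<open>\<sigma>\<close> on a neighbourhood of \<open>k\<close>, so
  only the quotient of cosine and square root is left to differentiate.\<close>

lemma has_real_derivative_deriv_theta0:
  assumes "\<bar>r\<bar> < 1" and "s * cos k \<noteq> 0"
  shows "(deriv (theta0 s r) has_real_derivative
           - sgn (s * cos k) * (r * (1 - r\<^sup>2) * sin k / sqrt (1 - r\<^sup>2 * (sin k)\<^sup>2) ^ 3)) (at k)"
proof -
  define \<sigma> where "\<sigma> = sgn (s * cos k)"
  have "\<forall>\<^sub>F x in nhds k. sgn (s * cos x) = \<sigma>"
    unfolding \<sigma>_def by (rule eventually_sgn_mult_cos[OF assms(2)])
  then have ev: "\<forall>\<^sub>F x in nhds k. deriv (theta0 s r) x =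
      - \<sigma> * (- r * cos x / sqrt (1 - r\<^sup>2 * (sin x)\<^sup>2))"
  proof eventually_elim
    case (elim x)
    have "s * cos x \<noteq> 0"
      using elim assms(2) by (auto simp: \<sigma>_def sgn_zero_iff)
    from DERIV_imp_deriv[OF has_real_derivative_theta0[OF assms(1) this]] elim
    show ?case by simp
  qed
  have "((\<lambda>x. - \<sigma> * (- r * cos x / sqrt (1 - r\<^sup>2 * (sin x)\<^sup>2))) has_real_derivative
      - \<sigma> * (r * (1 - r\<^sup>2) * sin k / sqrt (1 - r\<^sup>2 * (sin k)\<^sup>2) ^ 3)) (at k)"
    by (intro DERIV_cmult has_real_derivative_cos_over_sqrt assms)
  then show ?thesis
    unfolding DERIV_cong_ev[OF refl ev refl] by (simp add: \<sigma>_def)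
qed

section \<open>Jumps of \<open>theta0\<close> and regular momenta\<close>

lemma cos_theta0:
  assumes "\<bar>r\<bar> < 1"
  shows "cos (theta0 s r k) =
    (if s * cos k \<le> 0 then sqrt (1 - r\<^sup>2 * (sin k)\<^sup>2) else - sqrt (1 - r\<^sup>2 * (sin k)\<^sup>2))"
  using abs_mult_sin_less_1[OF assms, of k]
  by (auto simp: theta0_def cos_diff cos_arcsin power_mult_distrib)

text \<open>The jump is detected through the cosine of \<open>theta0\<close>, which is positive on
  one branch and negative on the other. Continuity at \<open>k\<close> would keep one sign nearby,
  although s cos x changes sign at \<open>k\<close>.\<close>

lemma not_differentiable_theta0:
  assumes "\<bar>r\<bar> < 1" and "s \<noteq> 0" and "cos k = 0"
  shows "\<not> theta0 s r differentiable (at k)"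
proof
  assume "theta0 s r differentiable (at k)"
  then have "isCont (\<lambda>x. cos (theta0 s r x)) k"
    by (intro continuous_intros differentiable_imp_continuous_within)
  \<comment> \<open>Since s cos k = 0, the first branch applies at \<open>k\<close> itself, and the
    cosine there is the positive root.\<close>
  moreover have "cos (theta0 s r k) > 0"
    using one_minus_sq_sin_pos[OF assms(1), of k] assms by (simp add: cos_theta0)
  ultimately have "\<forall>\<^sub>F x in nhds k. cos (theta0 s r x) > 0"
    by (auto simp: continuous_at tendsto_nhds_iff intro: order_tendstoD)
  then have "\<forall>\<^sub>F x in nhds k. s * cos x \<le> 0"
  proof eventually_elim
    case (elim x)
    have "sqrt (1 - r\<^sup>2 * (sin x)\<^sup>2) > 0"
      using one_minus_sq_sin_pos[OF assms(1), of x] by simp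
    then show ?case
      using elim by (auto simp: cos_theta0[OF assms(1)] split: if_splits)
  qed
  then obtain d where d: "d > 0" "\<And>x. dist x k < d \<Longrightarrow> s * cos x \<le> 0"
    by (auto simp: eventually_nhds_metric)
  \<comment> \<open>Thus \<open>s cos\<close> would have a local maximum at a zero of \<open>cos\<close>.\<close>
  have "((\<lambda>x. s * cos x) has_real_derivative s * - sin k) (at k)"
    by (auto intro!: derivative_eq_intros)
  then have "s * - sin k = 0"
    by (rule DERIV_local_max[OF _ d(1)]) (use d(2) assms(3) in \<open>auto simp: dist_real_def abs_minus_commute\<close>)
  then show False
    using assms(2,3) sin_cos_squared_add[of k] by simp
qed

text \<open>Where \<open>cos k\<close> vanishes the first derivative does not exist; elsewhere the
  second derivative is \<open>sin k\<close> times a nonzero factor.\<close>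

lemma regular_momentum_iff:
  assumes "\<bar>r\<bar> < 1" and "r \<noteq> 0" and "s \<noteq> 0"
  shows "regular_momentum s r k \<longleftrightarrow> sin k \<noteq> 0 \<and> cos k \<noteq> 0"
proof (cases "cos k = 0")
  case True
  then show ?thesis
    using not_differentiable_theta0[OF assms(1,3)] by (simp add: regular_momentum_def)
next
  case False
  then have nz: "s * cos k \<noteq> 0" using assms by simp
  have r2: "r\<^sup>2 \<noteq> 1" 
    using assms(1) by (auto simp: power2_eq_1_iff)
  show ?thesis
    using has_real_derivative_theta0[OF assms(1) nz]
      has_real_derivative_deriv_theta0[OF assms(1) nz]
      DERIV_imp_deriv[OF has_real_derivative_deriv_theta0[OF assms(1) nz]]
      one_minus_sq_sin_pos[OF assms(1), of k] nz assms(2) r2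
    by (auto simp: regular_momentum_def real_differentiable_def sgn_zero_iff)
qed

section \<open>The limit density along the group velocity\<close>

lemma limit_density_nonzero_iff:
  assumes "\<bar>r\<bar> < 1" and "r \<noteq> 0" and "s \<noteq> 0"
  shows "limit_density s r y \<noteq> 0 \<longleftrightarrow> \<bar>y\<bar> < \<bar>r\<bar> \<and> s * r * y > 0"
\<comment> \<open>The point 0 lies in both closed half-lines but is a zero of the factor y^2, hence
  the strict sign condition on \<open>s * r * y\<close>.\<close>
proof (cases "\<bar>y\<bar> < \<bar>r\<bar> \<and> y \<noteq> 0")
  case True
  then have "y\<^sup>2 < r\<^sup>2" "r\<^sup>2 < 1"
    using assms(1) by (simp_all add: abs_square_less_1 power2_strict_mono)
  moreover have "s * r \<noteq> 0" using assms by simp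
  ultimately show ?thesis
    using True assms
    by (auto simp: limit_density_def konno_density_def indicator_def zero_less_mult_iff mult_less_0_iff)
next
  case False
  then show ?thesis
    by (auto simp: limit_density_def konno_density_def indicator_def)
qed

text \<open>These rewrite the factors of \<open>limit_density\<close> that depend on
  \<open>y\<close>, using D^2 - r^2 cos^2 k = 1 - r^2 and D^2 - cos^2 k = (1 - r^2) sin^2 k.\<close>

lemma density_identities:
  fixes r k :: real
  assumes "\<bar>r\<bar> < 1" and "s \<noteq> 0" and "cos k \<noteq> 0"
  defines "D \<equiv> sqrt (1 - r\<^sup>2 * (sin k)\<^sup>2)" and "y \<equiv> group_velocity s r k"
  shows "D > 0" and "y\<^sup>2 = r\<^sup>2 * (cos k)\<^sup>2 / D\<^sup>2" and "1 - y\<^sup>2 = (1 - r\<^sup>2) / D\<^sup>2"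
    and "r\<^sup>2 - y\<^sup>2 = r\<^sup>2 * (1 - r\<^sup>2) * (sin k)\<^sup>2 / D\<^sup>2"
proof -
  show D: "D > 0"
    using one_minus_sq_sin_pos[OF assms(1), of k] by (simp add: D_def)
  have D2: "D\<^sup>2 = 1 - r\<^sup>2 * (sin k)\<^sup>2"
    using one_minus_sq_sin_pos[OF assms(1), of k] by (simp add: D_def)
  have y: "y = sgn s * r * \<bar>cos k\<bar> / D"
    unfolding y_def D_def using assms by (intro group_velocity_eq) auto
  have "(sgn s)\<^sup>2 = 1"
    using assms(2) by (simp add: sgn_if)
  then show y2: "y\<^sup>2 = r\<^sup>2 * (cos k)\<^sup>2 / D\<^sup>2"
    unfolding y by (simp add: power_divide power_mult_distrib)
  have "1 - y\<^sup>2 = (D\<^sup>2 - r\<^sup>2 * (cos k)\<^sup>2) / D\<^sup>2"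
    unfolding y2 using D by (simp add: field_simps)
  also have "D\<^sup>2 - r\<^sup>2 * (cos k)\<^sup>2 = 1 - r\<^sup>2"
    unfolding D2 cos_squared_eq by (simp add: algebra_simps)
  finally show "1 - y\<^sup>2 = (1 - r\<^sup>2) / D\<^sup>2" .
  have "r\<^sup>2 - y\<^sup>2 = r\<^sup>2 * (D\<^sup>2 - (cos k)\<^sup>2) / D\<^sup>2"
    unfolding y2 using D by (simp add: field_simps)
  also have "D\<^sup>2 - (cos k)\<^sup>2 = (1 - r\<^sup>2) * (sin k)\<^sup>2"
    unfolding D2 cos_squared_eq by (simp add: algebra_simps)
  finally show "r\<^sup>2 - y\<^sup>2 = r\<^sup>2 * (1 - r\<^sup>2) * (sin k)\<^sup>2 / D\<^sup>2"
    by (simp add: mult_ac)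
qed

text \<open>A nonzero \<open>sin k\<close> keeps the velocity strictly between -|r| and |r|, and its
  factor \<open>sgn s * r\<close> selects the half-line belonging to the sign of
  \<open>s * r\<close>. The same fact fixes a sign in \<open>group_velocity_surj\<close>.\<close>

lemma limit_density_group_velocity_nonzero:
  assumes "\<bar>r\<bar> < 1" and "r \<noteq> 0" and "s \<noteq> 0" and "sin k \<noteq> 0" and "cos k \<noteq> 0"
  shows "limit_density s r (group_velocity s r k) \<noteq> 0"
proof -
  define y where "y = group_velocity s r k"
  note id = density_identities[OF assms(1,3,5), folded y_def]
  have "r\<^sup>2 < 1"
    using assms(1) by (simp add: abs_square_less_1)
  then have "r\<^sup>2 - y\<^sup>2 > 0"
    unfolding id(4) using assms id(1) by (intro divide_pos_pos mult_pos_pos) auto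
  then have "\<bar>y\<bar> < \<bar>r\<bar>"
    by (simp flip: not_le add: abs_le_square_iff)
  moreover have "s * r * y = \<bar>s\<bar> * r\<^sup>2 * \<bar>cos k\<bar> / sqrt (1 - r\<^sup>2 * (sin k)\<^sup>2)"
    unfolding y_def using assms
    by (subst group_velocity_eq) (auto simp: abs_sgn power2_eq_square)
  then have "s * r * y > 0"
    using assms id(1) by simp
  ultimately show ?thesis
    using limit_density_nonzero_iff[OF assms(1-3)] by (simp add: y_def)
qed

lemma limit_density_group_velocity:
  assumes "\<bar>r\<bar> < 1" and "r \<noteq> 0" and "s \<noteq> 0" and "sin k \<noteq> 0" and "cos k \<noteq> 0"
  shows "limit_density s r (group_velocity s r k) =
    2 * (edge_density s r k)\<^sup>2 * effective_mass s r k / pi"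
proof -
  define y where "y = group_velocity s r k"
  \<comment> \<open>With the roots \<open>D\<close> and \<open>q\<close> as atoms, the final
    identity is one between rational expressions.\<close>
  define D where "D = sqrt (1 - r\<^sup>2 * (sin k)\<^sup>2)"
  define q where "q = sqrt (1 - r\<^sup>2)"
  note id = density_identities[OF assms(1,3,5), folded y_def D_def]
  have r2: "r\<^sup>2 < 1"
    using assms(1) by (simp add: abs_square_less_1)
  then have q: "q > 0" "q\<^sup>2 = 1 - r\<^sup>2" by (simp_all add: q_def)
  have nz: "s * cos k \<noteq> 0" using assms by simp
  have "limit_density s r y \<noteq> 0"
    unfolding y_def using limit_density_group_velocity_nonzero[OF assms] .
  then have y: "\<bar>y\<bar> < \<bar>r\<bar>" "s * r * y > 0"
    using limit_density_nonzero_iff[OF assms(1-3)] by auto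
  have "sqrt (r\<^sup>2 - y\<^sup>2) = \<bar>r\<bar> * q * \<bar>sin k\<bar> / D"
    unfolding id(4) using id(1) by (simp add: real_sqrt_mult real_sqrt_divide q_def)
  moreover have "limit_density s r y = 2 * s\<^sup>2 / r\<^sup>2 * y\<^sup>2 * (q / (pi * (1 - y\<^sup>2) * sqrt (r\<^sup>2 - y\<^sup>2)))"
    using y by (auto simp: limit_density_def konno_density_def indicator_def q_def
        zero_less_mult_iff mult_less_0_iff)
  ultimately have "limit_density s r y =
      2 * s\<^sup>2 / r\<^sup>2 * y\<^sup>2 * (q / (pi * (q\<^sup>2 / D\<^sup>2) * (\<bar>r\<bar> * q * \<bar>sin k\<bar> / D)))"
    by (simp only: id(3) q(2))
  then have lhs: "limit_density s r y =
      2 * s\<^sup>2 / r\<^sup>2 * (r\<^sup>2 * (cos k)\<^sup>2 / D\<^sup>2) *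
        (q / (pi * (q\<^sup>2 / D\<^sup>2) * (\<bar>r\<bar> * q * \<bar>sin k\<bar> / D)))"
    unfolding id(2) .
  have "deriv (deriv (theta0 s r)) k = - sgn (s * cos k) * (r * q\<^sup>2 * sin k / D ^ 3)"
    using DERIV_imp_deriv[OF has_real_derivative_deriv_theta0[OF assms(1) nz]]
    unfolding q(2) D_def .
  then have mass: "effective_mass s r k = D ^ 3 / (\<bar>r\<bar> * q\<^sup>2 * \<bar>sin k\<bar>)"
    using id(1) q(1) nz by (simp add: effective_mass_def abs_mult abs_sgn_eq)
  have edge: "(edge_density s r k)\<^sup>2 = s\<^sup>2 * (cos k)\<^sup>2 / D\<^sup>2"
    by (simp add: edge_density_def D_def[symmetric] power_divide power_mult_distrib)
  show ?thesis
    unfolding y_def[symmetric] lhs mass edge using id(1) q(1) assms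
    by (simp add: field_simps power2_eq_square power3_eq_cube)
qed

section \<open>Attained velocities and the parametric plot\<close>

lemma group_velocity_surj:
  assumes "\<bar>r\<bar> < 1" and "r \<noteq> 0" and "s \<noteq> 0" and "\<bar>y\<bar> < \<bar>r\<bar>" and "s * r * y > 0"
  obtains k where "k \<in> {0..<2 * pi}" and "sin k \<noteq> 0" and "cos k \<noteq> 0"
    and "group_velocity s r k = y"
proof -
  have r2: "r\<^sup>2 < 1" and y2: "y\<^sup>2 < r\<^sup>2"
    using assms by (simp_all add: abs_square_less_1 power2_strict_mono)
  have y0: "y \<noteq> 0" using assms(5) by auto
  \<comment> \<open>\<open>c\<close> is the positive solution of r^2 c^2 / (1 - r^2 (1 - c^2)) =
    y^2, the equation v^2 = y^2 with \<open>c\<close> for \<open>cos k\<close>.\<close>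
  define c where "c = sqrt (y\<^sup>2 * (1 - r\<^sup>2) / (r\<^sup>2 * (1 - y\<^sup>2)))"
  have c2: "c\<^sup>2 = y\<^sup>2 * (1 - r\<^sup>2) / (r\<^sup>2 * (1 - y\<^sup>2))"
    unfolding c_def using r2 y2 by (intro real_sqrt_pow2) simp
  have c0: "c > 0"
    unfolding c_def using r2 y2 y0 assms(2) by simp
  \<comment> \<open>The difference is r^2 - y^2, so the bound on \<open>y\<close> is exactly what
    makes \<open>c\<close> a cosine with nonzero sine.\<close>
  have "r\<^sup>2 * (1 - y\<^sup>2) - y\<^sup>2 * (1 - r\<^sup>2) > 0"
    using y2 by (simp add: algebra_simps)
  then have "c\<^sup>2 < 1"
    unfolding c2 using r2 y2 assms(2) by (simp add: divide_less_eq)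
  then have c1: "c < 1"
    using c0 by (simp add: abs_square_less_1)
  define k where "k = arccos c"
  have cos: "cos k = c" and bounds: "0 < k" "k < pi"
    using c0 c1 by (simp_all add: k_def arccos_lt_bounded)
  have "sin k > 0" using bounds by (rule sin_gt_zero)
  define v where "v = group_velocity s r k"
  have cos0: "cos k \<noteq> 0" using cos c0 by simp
  note id = density_identities[OF assms(1,3) cos0, folded v_def]
  have "v\<^sup>2 = r\<^sup>2 * c\<^sup>2 / (1 - r\<^sup>2 * (1 - c\<^sup>2))"
    using id(1,2) by (simp add: cos sin_squared_eq)
  also have "1 - r\<^sup>2 * (1 - c\<^sup>2) = (1 - r\<^sup>2) / (1 - y\<^sup>2)"
    unfolding c2 using r2 y2 assms(2) by (simp add: field_simps)
  also have "r\<^sup>2 * c\<^sup>2 = y\<^sup>2 * ((1 - r\<^sup>2) / (1 - y\<^sup>2))"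
    unfolding c2 using assms(2) by simp
  also have "\<dots> / ((1 - r\<^sup>2) / (1 - y\<^sup>2)) = y\<^sup>2"
    using r2 y2 by simp
  finally have "v = y \<or> v = - y"
    by (simp add: power2_eq_iff)
  \<comment> \<open>Squares determine \<open>v\<close> only up to sign; \<open>v\<close> and
    \<open>y\<close> agree because both have the sign of \<open>s * r\<close>.\<close>
  moreover have "s * r * v > 0"
    using limit_density_group_velocity_nonzero[OF assms(1-3), of k] \<open>sin k > 0\<close> cos0
      limit_density_nonzero_iff[OF assms(1-3)] by (simp add: v_def)
  ultimately have "v = y"
    using assms(5) by auto
  with that[of k] show thesis
    using bounds \<open>sin k > 0\<close> cos0 by (simp add: v_def)
qed

text \<open>Both sides leave out degenerate points. At a regular momentum the second coordinate is
  positive, so no point with vanishing density is attained. At \<open>0\<close> and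
  \<open>pi\<close> the convention \<open>1 / 0 = 0\<close> would turn an infinite mass into 0, and
  at the jumps \<open>deriv\<close> has no meaning.\<close>

theorem corollary3:
  fixes \<alpha> \<beta> s r :: real
  assumes "\<alpha> \<in> {0..<2 * pi}" and "\<beta> \<in> {0..<2 * pi}"
    and "s = sin (\<alpha> + \<beta>)" and "s \<noteq> 0"
    and "r = sin (\<alpha> - \<beta>)" and "0 < \<bar>r\<bar>" and "\<bar>r\<bar> < 1"
  shows "{(y, limit_density s r y) | y. limit_density s r y \<noteq> 0} =
         {(group_velocity s r k, 2 * (edge_density s r k)\<^sup>2 * effective_mass s r k / pi) | k.
            k \<in> {0..<2 * pi} \<and> regular_momentum s r k}"
proof -
  have r: "\<bar>r\<bar> < 1" "r \<noteq> 0" and s: "s \<noteq> 0" using assms by auto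
  note reg = regular_momentum_iff[OF r s]
    and density = limit_density_group_velocity[OF r s]
  show ?thesis (is "?L = ?R")
  proof (intro subset_antisym subsetI)
    fix p assume "p \<in> ?L"
    then obtain y where p: "p = (y, limit_density s r y)" and "limit_density s r y \<noteq> 0"
      by blast
    then have "\<bar>y\<bar> < \<bar>r\<bar>" "s * r * y > 0"
      using limit_density_nonzero_iff[OF r s] by auto
    then obtain k where "k \<in> {0..<2 * pi}" "sin k \<noteq> 0" "cos k \<noteq> 0" "group_velocity s r k = y"
      using group_velocity_surj[OF r s] by metis
    then show "p \<in> ?R"
      using density[of k] reg[of k] p by blast
  next
    fix p assume "p \<in> ?R"
    then obtain k where "sin k \<noteq> 0" "cos k \<noteq> 0"
      and p: "p = (group_velocity s r k, 2 * (edge_density s r k)\<^sup>2 * effective_mass s r k / pi)"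
      using reg by blast
    then show "p \<in> ?L"
      using density[of k] limit_density_group_velocity_nonzero[OF r s, of k] by fastforce
  qed
qed

end
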